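(* Let $f,g:\mathbb{R}^N\to\mathbb{R}\cup\{+\infty\}$, $F=f+g$ and $\mathcal{D}=\operatorname{int}(\operatorname{dom} f)$ satisfy assumptions (A1), (A2) of the context, let $x^0\in\operatorname{dom} g$, and let $(x^k)_{k\in\mathbb{N}}$ be the sequence generated by the variable Bregman majorization-minimization (MM) algorithm of the context. Assume moreover: (A3)(a) there exists $\underline{\gamma}>0$ such that, for every $k\in\mathbb{N}$ and every $x\in\operatorname{dom} g$, $Q_f(x,x^k)-f(x)\ge \frac{\gamma_k}{2}\|x-x^k\|^2$ with $\gamma_k\in[\underline{\gamma},+\infty)$; (A3)(b) there exists $\overline{L}>0$ such that, for every $k\in\mathbb{N}$, $\nabla f-\nabla h_{x^k}$ is $L_k$-Lipschitz on every compact subset of $\operatorname{dom} g$, with $L_k\le\overline{L}$; (A4) $F$ satisfies the Kurdyka–Łojasiewicz property at each point of $\operatorname{dom}(\partial F)=\operatorname{dom}(\partial g)$. Then $(x^k)_{k\in\mathbb{N}}$ has finite length, i.e. $\sum_{k=1}^{+\infty}\|x^{k+1}-x^k\|<+\infty$, and $(x^k)_{k\in\mathbb{N}}$ converges to a critical point of $F$.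
   Context: $\|\cdot\|$ and $\langle\cdot,\cdot\rangle$ are the Euclidean norm and inner product of $\mathbb{R}^N$; $\operatorname{dom} f=\{x: f(x)<+\infty\}$; $\Gamma_0(\mathbb{R}^N)$ is the set of proper lower semicontinuous convex functions $\mathbb{R}^N\to\mathbb{R}\cup\{+\infty\}$; $\partial$ denotes the limiting subdifferential, and $\operatorname{dom}(\partial F)=\{x:\partial F(x)\neq\emptyset\}$. A critical point of $F$ is a point $x$ with $0\in\partial F(x)$. Legendre functions. $h\in\Gamma_0(\mathbb{R}^N)$ is essentially smooth if it is differentiable on $\operatorname{int}(\operatorname{dom} h)$ and $\|\nabla h(y^k)\|\to+\infty$ for every sequence $(y^k)$ in $\operatorname{int}(\operatorname{dom} h)$ converging to a boundary point of $\operatorname{dom} h$. It is Legendre if it is essentially smooth and strictly convex on $\operatorname{int}(\operatorname{dom} h)$. $\mathcal{L}(\mathbb{R}^N)$ is the set of Legendre functions. For $h\in\mathcal{L}(\mathbb{R}^N)$ and $(x,y)\in\operatorname{dom} h\times\operatorname{int}(\operatorname{dom} h)$, the Bregman distance is $D_h(x,y)=h(x)-h(y)-\langle\nabla h(y),x-y\rangle$. (A1) (a) $f:\mathbb{R}^N\to\mathbb{R}\cup\{+\infty\}$ is proper, $\mathcal{D}:=\operatorname{int}(\operatorname{dom} f)$ is nonempty and $f$ is continuously differentiable on $\mathcal{D}$. (b) $g:\mathbb{R}^N\to\mathbb{R}\cup\{+\infty\}$ is proper, lower semicontinuous, convex, with $\operatorname{dom} g\subset\mathcal{D}$. (c) $F=f+g$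 is coercive, continuous on its domain, and bounded below by some $\underline{F}>-\infty$. (A2) There is a family $(h_z)_{z\in\mathcal{D}}$ in $\mathcal{L}(\mathbb{R}^N)$ with $\mathcal{D}\subset\operatorname{int}(\operatorname{dom} h_z)$ for every $z\in\mathcal{D}$ such that, with $Q_f(x,z)=f(z)+\langle\nabla f(z),x-z\rangle+D_{h_z}(x,z)$, one has $f(x)\le Q_f(x,z)$ for all $x,z\in\mathcal{D}$ ($Q_f(\cdot,z)$ is a Bregman tangent majorant of $f$ at $z$ associated with $h_z$). Algorithm. Starting from $x^0\in\operatorname{dom} g$, for $k=0,1,\dots$: $x^{k+1}=\operatorname{argmin}_{x\in\mathbb{R}^N}\big(Q_f(x,x^k)+g(x)\big)$, where the objective is $+\infty$ outside $\operatorname{dom} g$. (Under (A1), (A2) this minimizer exists, is unique and lies in $\operatorname{dom} g$.) Kurdyka–Łojasiewicz (KŁ) property. For $\eta>0$ let $\Phi_\eta$ be the set of $\phi\in\mathcal{C}^0([0,\eta))\cap\mathcal{C}^1((0,\eta))$ with $\phi(0)=0$, $\phi$ concave, and $\phi'>0$ on $(0,\eta)$. A function $F$ has the KŁ property at $\bar{x}\in\operatorname{dom}(\partial F)$ if there exist $\eta>0$, a neighborhood $U$ of $\bar{x}$ and $\phi\in\Phi_\eta$ such that $\phi'(F(x)-F(\bar{x}))\,d(0,\partial F(x))\ge 1$ for every $x\in U$ with $F(\bar{x})<F(x)<F(\bar{x})+\eta$, where $d(0,\partial F(x))=\inf\{\|u\|: u\in\partial F(x)\}$. *)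

theory Defs
  imports "HOL-Analysis.Analysis"
begin

text \<open>
  Functions \<open>\<real>\<^sup>N \<rightarrow> \<real> \<union> {+\<infinity>}\<close> are rendered as functions into \<^typ>\<open>ereal\<close>; the value \<open>-\<infinity>\<close> is
  excluded by \<open>proper\<close>.
\<close>

definition edom :: "('a \<Rightarrow> ereal) \<Rightarrow> 'a set" where
  "edom f = {x. f x < \<infinity>}"

definition proper :: "('a \<Rightarrow> ereal) \<Rightarrow> bool" where
  "proper f \<longleftrightarrow> (\<forall>x. f x \<noteq> - \<infinity>) \<and> edom f \<noteq> {}"

definition lsc :: "('a::topological_space \<Rightarrow> ereal) \<Rightarrow> bool" where
  "lsc f \<longleftrightarrow> (\<forall>x. f x \<le> Liminf (at x) f)"

text \<open>
  The real-valued part of \<open>f\<close>; it agrees with \<open>f\<close> where \<open>f\<close> is finite, and is used only there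
  (its value is \<open>0\<close> elsewhere).
\<close>

abbreviation rpart :: "('a \<Rightarrow> ereal) \<Rightarrow> 'a \<Rightarrow> real" where
  "rpart f \<equiv> \<lambda>x. real_of_ereal (f x)"

text \<open>\<open>Gamma0\<close> is the set of proper lower semicontinuous convex functions.\<close>

definition Gamma0 :: "('a::euclidean_space \<Rightarrow> ereal) set" where
  "Gamma0 = {f. proper f \<and> lsc f \<and> convex_on (edom f) (rpart f)}"

text \<open>
  The gradient is meaningful at interior points of the domain at which the real part is
  differentiable.
\<close>

definition grad :: "('a::euclidean_space \<Rightarrow> ereal) \<Rightarrow> 'a \<Rightarrow> 'a" where
  "grad f x = (THE v. GDERIV (rpart f) x :> v)"

subsection \<open>Limiting subdifferential\<close>

definition frechet_subdiff :: "('a::euclidean_space \<Rightarrow> ereal) \<Rightarrow> 'a \<Rightarrow> 'a set" where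
  "frechet_subdiff F x =
    {v. \<bar>F x\<bar> \<noteq> \<infinity> \<and>
        0 \<le> Liminf (at x) (\<lambda>y. (F y - F x - ereal (v \<bullet> (y - x))) / ereal (norm (y - x)))}"

definition limiting_subdiff :: "('a::euclidean_space \<Rightarrow> ereal) \<Rightarrow> 'a \<Rightarrow> 'a set" where
  "limiting_subdiff F x =
    {v. \<bar>F x\<bar> \<noteq> \<infinity> \<and>
        (\<exists>(y :: nat \<Rightarrow> 'a) u. y \<longlonglongrightarrow> x \<and> (\<lambda>n. F (y n)) \<longlonglongrightarrow> F x \<and>
           (\<forall>n. u n \<in> frechet_subdiff F (y n)) \<and> u \<longlonglongrightarrow> v)}"

definition subdiff_dom :: "('a::euclidean_space \<Rightarrow> ereal) \<Rightarrow> 'a set" where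
  "subdiff_dom F = {x. limiting_subdiff F x \<noteq> {}}"

definition critical_point :: "('a::euclidean_space \<Rightarrow> ereal) \<Rightarrow> 'a \<Rightarrow> bool" where
  "critical_point F x \<longleftrightarrow> 0 \<in> limiting_subdiff F x"

subsection \<open>Legendre functions and Bregman majorants\<close>

definition essentially_smooth :: "('a::euclidean_space \<Rightarrow> ereal) \<Rightarrow> bool" where
  "essentially_smooth h \<longleftrightarrow>
    (\<forall>x \<in> interior (edom h). rpart h differentiable (at x)) \<and>
    (\<forall>(y :: nat \<Rightarrow> 'a) b. (\<forall>k. y k \<in> interior (edom h)) \<longrightarrow> b \<in> frontier (edom h) \<longrightarrow> y \<longlonglongrightarrow> b
       \<longrightarrow> filterlim (\<lambda>k. norm (grad h (y k))) at_top sequentially)"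

definition strictly_convex_on :: "'a::real_vector set \<Rightarrow> ('a \<Rightarrow> real) \<Rightarrow> bool" where
  "strictly_convex_on S f \<longleftrightarrow> convex S \<and>
    (\<forall>x\<in>S. \<forall>y\<in>S. \<forall>u>0. \<forall>v>0. x \<noteq> y \<longrightarrow> u + v = 1
       \<longrightarrow> f (u *\<^sub>R x + v *\<^sub>R y) < u * f x + v * f y)"

definition Legendre :: "('a::euclidean_space \<Rightarrow> ereal) set" where
  "Legendre = {h. h \<in> Gamma0 \<and> essentially_smooth h \<and>
     strictly_convex_on (interior (edom h)) (rpart h)}"

text \<open>
  For \<open>y\<close> in the interior of the domain of \<open>h\<close>, this is the Bregman distance, extended by
  \<open>+\<infinity>\<close> to points \<open>x\<close> outside the domain.
\<close>

definition bregman :: "('a::euclidean_space \<Rightarrow> ereal) \<Rightarrow> 'a \<Rightarrow> 'a \<Rightarrow> ereal" where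
  "bregman h x y = h x - h y - ereal (grad h y \<bullet> (x - y))"

definition bregman_majorant ::
  "('a::euclidean_space \<Rightarrow> ereal) \<Rightarrow> ('a \<Rightarrow> 'a \<Rightarrow> ereal) \<Rightarrow> 'a \<Rightarrow> 'a \<Rightarrow> ereal" where
  "bregman_majorant f h x z = f z + ereal (grad f z \<bullet> (x - z)) + bregman (h z) x z"

text \<open>
  Since \<open>a + \<infinity> = \<infinity>\<close> for every \<open>a\<close> in \<^typ>\<open>ereal\<close>, the objective is \<open>+\<infinity>\<close> outside the domain of \<open>g\<close>.
\<close>

definition bregman_MM ::
  "('a::euclidean_space \<Rightarrow> ereal) \<Rightarrow> ('a \<Rightarrow> ereal) \<Rightarrow> ('a \<Rightarrow> 'a \<Rightarrow> ereal) \<Rightarrow> 'a \<Rightarrow> (nat \<Rightarrow> 'a) \<Rightarrow> bool" where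
  "bregman_MM f g h x0 x \<longleftrightarrow> x 0 = x0 \<and>
    (\<forall>k. is_arg_min (\<lambda>y. bregman_majorant f h y (x k) + g y) (\<lambda>_. True) (x (Suc k)))"

subsection \<open>Kurdyka-Lojasiewicz property\<close>

definition KL_desingularizing :: "real \<Rightarrow> (real \<Rightarrow> real) set" where
  "KL_desingularizing \<eta> =
    {\<phi>. continuous_on {0..<\<eta>} \<phi> \<and>
        (\<forall>s\<in>{0<..<\<eta>}. \<phi> differentiable (at s)) \<and> continuous_on {0<..<\<eta>} (deriv \<phi>) \<and>
        \<phi> 0 = 0 \<and> concave_on {0..<\<eta>} \<phi> \<and> (\<forall>s\<in>{0<..<\<eta>}. deriv \<phi> s > 0)}"

text \<open>The distance \<open>d(0, \<partial>F(x))\<close>, which is \<open>+\<infinity>\<close> if \<open>\<partial>F(x)\<close> is empty.\<close>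

definition subdiff_dist :: "('a::euclidean_space \<Rightarrow> ereal) \<Rightarrow> 'a \<Rightarrow> ereal" where
  "subdiff_dist F x = (INF u\<in>limiting_subdiff F x. ereal (norm u))"

definition KL_property :: "('a::euclidean_space \<Rightarrow> ereal) \<Rightarrow> 'a \<Rightarrow> bool" where
  "KL_property F xbar \<longleftrightarrow>
    (\<exists>\<eta>>0. \<exists>U. \<exists>\<phi>\<in>KL_desingularizing \<eta>. open U \<and> xbar \<in> U \<and>
       (\<forall>x\<in>U. F xbar < F x \<longrightarrow> F x < F xbar + ereal \<eta> \<longrightarrow>
          1 \<le> ereal (deriv \<phi> (real_of_ereal (F x - F xbar))) * subdiff_dist F x))"

end

theory Submission
  imports Defs
begin

text \<open>
  The majorization gap gives the sufficient decrease
  \<open>\<gamma>/2 \<parallel>x\<^sub>k\<^sub>+\<^sub>1 - x\<^sub>k\<parallel>\<^sup>2 \<le> F(x\<^sub>k) - F(x\<^sub>k\<^sub>+\<^sub>1)\<close>. Optimality of \<open>x\<^sub>k\<^sub>+\<^sub>1\<close> puts the difference of the values of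
  \<open>\<nabla>f - \<nabla>h\<^sub>k\<close> at \<open>x\<^sub>k\<^sub>+\<^sub>1\<close> and \<open>x\<^sub>k\<close> into the Frechet subdifferential of \<open>F\<close> at \<open>x\<^sub>k\<^sub>+\<^sub>1\<close>, so that the
  subdifferential residual is at most \<open>L \<parallel>x\<^sub>k\<^sub>+\<^sub>1 - x\<^sub>k\<parallel>\<close>. Hence every cluster point is critical. Near a
  cluster point the Kurdyka-Lojasiewicz inequality bounds twice a step by the previous step plus a
  telescoping term; once the sequence is close enough to the cluster point it therefore stays in
  the neighbourhood where the inequality holds, and its length is finite.
\<close>

section \<open>Finite length from the Kurdyka-Lojasiewicz inequality\<close>

text \<open>A concave function lies below its tangents. Differentiability enters only at
  \<open>s\<close>, so the endpoint \<open>t = 0\<close>, where \<open>\<phi>\<close> need not be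
  differentiable, is allowed.\<close>

lemma KL_desingularizing_tangent:
  assumes "\<phi> \<in> KL_desingularizing \<eta>" "0 < s" "s < \<eta>" "0 \<le> t" "t < \<eta>"
  shows "\<phi> t \<le> \<phi> s + deriv \<phi> s * (t - s)"
proof -
  have "convex_on {0..<\<eta>} (\<lambda>u. - \<phi> u)" and "\<phi> differentiable (at s)"
    using assms by (auto simp: KL_desingularizing_def concave_on_def)
  then have "(\<phi> has_real_derivative deriv \<phi> s) (at s within {0..<\<eta>})"
    using DERIV_deriv_iff_real_differentiable has_field_derivative_at_within by blast
  then have "((\<lambda>u. - \<phi> u) has_real_derivative - deriv \<phi> s) (at s within {0..<\<eta>})"
    by (rule DERIV_minus)
  with \<open>convex_on {0..<\<eta>} _\<close> have "- \<phi> t - (- \<phi> s) \<ge> - deriv \<phi> s * (t - s)"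
    using assms by (intro convex_on_imp_above_tangent[where A = "{0..<\<eta>}"]) auto
  then show ?thesis by simp
qed

lemma KL_desingularizing_nonneg:
  assumes "\<phi> \<in> KL_desingularizing \<eta>" "0 \<le> s" "s < \<eta>"
  shows "0 \<le> \<phi> s"
proof (cases "s = 0")
  case True
  then show ?thesis using assms by (simp add: KL_desingularizing_def)
next
  case False
  have "\<phi> 0 = 0" "deriv \<phi> s > 0"
    using assms False by (auto simp: KL_desingularizing_def)
  moreover have "\<phi> 0 \<le> \<phi> s + deriv \<phi> s * (0 - s)"
    using assms False by (intro KL_desingularizing_tangent[of _ \<eta>]) auto
  ultimately show ?thesis
    using assms(2) by (smt (verit) mult_nonneg_nonneg mult_minus_right)
qed

text \<open>Here \<open>d\<close>, \<open>d'\<close> stand for consecutive step lengths and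
  \<open>r\<close>, \<open>r'\<close> for consecutive gaps of the objective to its limit. Concavity
  and \<open>dec\<close> bound \<open>deriv \<phi> r * (a * d'\<^sup>2)\<close> by
  \<open>\<phi> r - \<phi> r'\<close>. Inserting \<open>KL\<close> gives
  \<open>d'\<^sup>2 \<le> d * \<Delta>\<close>, and the arithmetic-geometric mean inequality
  finishes.\<close>

lemma KL_step:
  assumes \<phi>: "\<phi> \<in> KL_desingularizing \<eta>"
    and a: "a > 0" and b: "b \<ge> 0" and d: "d \<ge> 0" "d' \<ge> 0"
    and r: "0 \<le> r'" "r < \<eta>"
    and dec: "a * d'\<^sup>2 \<le> r - r'"
    and KL: "0 < r \<Longrightarrow> 1 \<le> deriv \<phi> r * (b * d)"
  shows "2 * d' \<le> d + b / a * (\<phi> r - \<phi> r')"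
proof (cases "r > 0")
  case False
  have "0 \<le> a * d'\<^sup>2" using a by simp
  with dec r False have "r = 0" "r' = 0" by linarith+
  with dec a d have "d' = 0" by (simp add: mult_le_0_iff)
  with \<open>r = 0\<close> \<open>r' = 0\<close> d show ?thesis by simp
next
  case True
  have pos: "deriv \<phi> r > 0" using \<phi> True r by (auto simp: KL_desingularizing_def)
  have "0 \<le> a * d'\<^sup>2" using a by simp
  with dec r have "r' < \<eta>" by linarith
  then have "\<phi> r' \<le> \<phi> r + deriv \<phi> r * (r' - r)"
    using \<phi> True r by (intro KL_desingularizing_tangent) auto
  moreover have "deriv \<phi> r * (a * d'\<^sup>2) \<le> deriv \<phi> r * (r - r')"
    using dec pos by (intro mult_left_mono) auto
  ultimately have *: "deriv \<phi> r * (a * d'\<^sup>2) \<le> \<phi> r - \<phi> r'"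
    by (simp add: algebra_simps)
  define \<Delta> where "\<Delta> = b / a * (\<phi> r - \<phi> r')"
  have "d'\<^sup>2 \<le> (deriv \<phi> r * (b * d)) * d'\<^sup>2"
    using KL[OF True] by (simp add: mult_le_cancel_right1)
  also have "\<dots> = d * (b / a * (deriv \<phi> r * (a * d'\<^sup>2)))"
    using a by (simp add: field_simps)
  also have "\<dots> \<le> d * \<Delta>"
    unfolding \<Delta>_def using * a b d by (intro mult_left_mono) auto
  finally have "d'\<^sup>2 \<le> d * \<Delta>" .
  moreover have "0 \<le> \<Delta>"
    unfolding \<Delta>_def using * pos a b by (intro mult_nonneg_nonneg order_trans[OF _ *]) auto
  moreover have "0 \<le> (d - \<Delta>)\<^sup>2" by simp
  ultimately have "(2 * d')\<^sup>2 \<le> (d + \<Delta>)\<^sup>2"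
    by (simp add: power2_eq_square algebra_simps)
  then have "2 * d' \<le> d + \<Delta>"
    by (rule power2_le_imp_le) (simp add: \<open>0 \<le> \<Delta>\<close> d)
  then show ?thesis by (simp add: \<Delta>_def)
qed

lemma convergent_of_summable_steps:
  fixes x :: "nat \<Rightarrow> 'a::banach"
  assumes "summable (\<lambda>k. norm (x (Suc k) - x k))"
  shows "convergent x"
proof -
  have "summable (\<lambda>k. x (Suc k) - x k)" using assms by (rule summable_norm_cancel)
  then have "convergent (\<lambda>n. \<Sum>k<n. x (Suc k) - x k)" by (simp add: summable_iff_convergent)
  then have "convergent (\<lambda>n. x 0 + (x n - x 0))"
    by (intro convergent_add convergent_const) (simp add: sum_lessThan_telescope)
  then show ?thesis by simp
qed

lemma steps_tendsto_zero:
  fixes x :: "nat \<Rightarrow> 'a::real_normed_vector" and r :: "nat \<Rightarrow> real"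
  assumes "a > 0" "r \<longlonglongrightarrow> l"
    and dec: "\<And>k. a * (norm (x (Suc k) - x k))\<^sup>2 \<le> r k - r (Suc k)"
  shows "(\<lambda>k. norm (x (Suc k) - x k)) \<longlonglongrightarrow> 0"
proof -
  have lim: "(\<lambda>k. (r k - r (Suc k)) / a) \<longlonglongrightarrow> (l - l) / a"
    using \<open>a > 0\<close> by (intro tendsto_divide tendsto_diff assms(2) LIMSEQ_Suc[OF assms(2)] tendsto_const) auto
  have upper: "(norm (x (Suc k) - x k))\<^sup>2 \<le> (r k - r (Suc k)) / a" for k
    using \<open>a > 0\<close> dec[of k] by (metis mult.commute mult_imp_le_div_pos)
  have "(\<lambda>k. (norm (x (Suc k) - x k))\<^sup>2) \<longlonglongrightarrow> 0"
    by (rule real_tendsto_sandwich[of "\<lambda>_. 0" _ _ "\<lambda>k. (r k - r (Suc k)) / a"]) (use lim upper in auto)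
  then have "(\<lambda>k. sqrt ((norm (x (Suc k) - x k))\<^sup>2)) \<longlonglongrightarrow> sqrt 0" by (rule tendsto_real_sqrt)
  then show ?thesis by simp
qed

text \<open>The abstract descent argument, with \<open>r\<close> the gap of the values to their
  limit. The step in \<open>KL\<close> is the one leading to \<open>x (Suc k)\<close>, because the
  residual at an iterate is controlled by the preceding step.\<close>

lemma KL_finite_length:
  fixes x :: "nat \<Rightarrow> 'a::banach" and r :: "nat \<Rightarrow> real"
  assumes \<phi>: "\<phi> \<in> KL_desingularizing \<eta>" and \<eta>: "\<eta> > 0" and U: "open U" "xbar \<in> U"
    and a: "a > 0" and b: "b \<ge> 0"
    and r: "\<And>k. 0 \<le> r k" "r \<longlonglongrightarrow> 0"
    and dec: "\<And>k. a * (norm (x (Suc k) - x k))\<^sup>2 \<le> r k - r (Suc k)"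
    and KL: "\<And>k. x (Suc k) \<in> U \<Longrightarrow> 0 < r (Suc k) \<Longrightarrow> r (Suc k) < \<eta> \<Longrightarrow>
      1 \<le> deriv \<phi> (r (Suc k)) * (b * norm (x (Suc k) - x k))"
    and s: "strict_mono s" "(x \<circ> s) \<longlonglongrightarrow> xbar"
  shows "summable (\<lambda>k. norm (x (Suc k) - x k))" "x \<longlonglongrightarrow> xbar"
proof -
  define d where "d k = norm (x (Suc k) - x k)" for k
  define C where "C = b / a"
  have d0: "0 \<le> d k" for k by (simp add: d_def)
  have C0: "0 \<le> C" using a b by (simp add: C_def)
  \<comment> \<open>The radius is split into thirds: one for the distance of a starting iterate from
    \<open>xbar\<close>, one for the step leading to that iterate, one for the value of
    \<open>C * \<phi>\<close> at its gap.\<close>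
  obtain \<rho> where \<rho>: "\<rho> > 0" "ball xbar \<rho> \<subseteq> U" using U open_contains_ball by blast
  have r_lim: "\<forall>\<^sub>F k in sequentially. r k < \<eta>" using r(2) \<eta> by (rule order_tendstoD)
  have "(\<lambda>k. \<phi> (r k)) \<longlonglongrightarrow> \<phi> 0"
    using \<phi> \<eta> r r_lim
    by (intro continuous_on_tendsto_compose[of "{0..<\<eta>}" \<phi> r])
       (auto simp: KL_desingularizing_def elim: eventually_mono)
  then have "(\<lambda>k. C * \<phi> (r k)) \<longlonglongrightarrow> C * 0"
    using \<phi> by (intro tendsto_mult tendsto_const) (simp add: KL_desingularizing_def)
  then have \<phi>_lim: "\<forall>\<^sub>F k in sequentially. C * \<phi> (r k) < \<rho> / 3"
    using \<rho> by (intro order_tendstoD) auto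
  have "d \<longlonglongrightarrow> 0" unfolding d_def using a r(2) dec by (rule steps_tendsto_zero)
  then have d_lim: "\<forall>\<^sub>F k in sequentially. d k < \<rho> / 3"
    using \<rho>(1) by (intro order_tendstoD(2)) auto
  have "\<forall>\<^sub>F k in sequentially. r k < \<eta> \<and> C * \<phi> (r k) < \<rho> / 3 \<and> d k < \<rho> / 3"
    using r_lim \<phi>_lim d_lim by eventually_elim auto
  then obtain N where N: "\<And>k. k \<ge> N \<Longrightarrow> r k < \<eta> \<and> C * \<phi> (r k) < \<rho> / 3 \<and> d k < \<rho> / 3"
    by (auto simp: eventually_sequentially)
  have "\<forall>\<^sub>F n in sequentially. dist ((x \<circ> s) n) xbar < \<rho> / 3"
    using s(2) \<rho>(1) by (intro tendstoD) (auto simp del: o_apply)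
  then have "\<forall>\<^sub>F n in sequentially. dist (x (s n)) xbar < \<rho> / 3 \<and> n \<ge> Suc N"
    using eventually_ge_at_top[of "Suc N"] by eventually_elim simp
  then obtain m where m: "dist (x (s m)) xbar < \<rho> / 3" "m \<ge> Suc N"
    using eventually_happens' trivial_limit_sequentially by blast
  \<comment> \<open>The starting index is written as a successor so that the step \<open>d K\<close>
    leading to the starting iterate exists and is already small.\<close>
  have "s m \<ge> Suc N" using m(2) seq_suble[OF s(1), of m] by simp
  then obtain K where K: "s m = Suc K" "K \<ge> N" by (cases "s m") auto
  \<comment> \<open>The induction also keeps the iterates in \<open>ball xbar \<rho>\<close>: the bound on the length up to step \<open>n\<close>
    places the next iterate in it, which makes the inequality available for the next step.\<close>
  have bound: "(\<Sum>i<n. d (Suc K + i)) + d (K + n)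
      \<le> d K + C * (\<phi> (r (Suc K)) - \<phi> (r (Suc K + n)))" for n
  proof (induction n)
    case 0
    then show ?case by simp
  next
    case (Suc n)
    have "\<phi> (r (Suc K + n)) \<ge> 0"
      using N[of "Suc K + n"] K r by (intro KL_desingularizing_nonneg[OF \<phi>]) auto
    then have "C * (\<phi> (r (Suc K)) - \<phi> (r (Suc K + n))) \<le> C * \<phi> (r (Suc K))"
      using C0 by (intro mult_left_mono) auto
    with Suc d0[of "K + n"] N[of K] N[of "Suc K"] K
    have len: "(\<Sum>i<n. d (Suc K + i)) < 2 * \<rho> / 3" by simp
    have "x (Suc K + n) - x (Suc K) = (\<Sum>i<n. x (Suc (Suc K + i)) - x (Suc K + i))"
      using sum_lessThan_telescope[of "\<lambda>i. x (Suc K + i)" n] by simp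
    then have "norm (x (Suc K + n) - x (Suc K)) \<le> (\<Sum>i<n. d (Suc K + i))"
      unfolding d_def by (simp add: norm_sum)
    with len have "dist (x (Suc K + n)) (x (Suc K)) < 2 * \<rho> / 3" by (simp add: dist_norm)
    moreover have "dist (x (Suc K + n)) xbar \<le> dist (x (Suc K + n)) (x (Suc K)) + dist (x (Suc K)) xbar"
      by (rule dist_triangle)
    ultimately have "dist (x (Suc K + n)) xbar < \<rho>" using m(1) K(1) by simp
    then have "x (Suc (K + n)) \<in> U" using \<rho> by (auto simp: dist_commute)
    \<comment> \<open>The \<open>d (K + n)\<close> on the right cancels the one carried on the left
      of the induction hypothesis. Of the two copies of the new step, one joins the sum and the
      other is carried on.\<close>
    then have "2 * d (Suc (K + n)) \<le> d (K + n) + C * (\<phi> (r (Suc (K + n))) - \<phi> (r (Suc (Suc (K + n)))))"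
      unfolding C_def using N[of "Suc (K + n)"] K d0 r KL[of "K + n"] dec[of "Suc (K + n)"]
      by (intro KL_step[OF \<phi> a b]) (auto simp: d_def)
    with Suc show ?case by (simp add: algebra_simps)
  qed
  have "(\<Sum>i<n. d (i + Suc K)) \<le> d K + C * \<phi> (r (Suc K))" for n
  proof -
    have "\<phi> (r (Suc K + n)) \<ge> 0"
      using N[of "Suc K + n"] K r by (intro KL_desingularizing_nonneg[OF \<phi>]) auto
    then have "C * (\<phi> (r (Suc K)) - \<phi> (r (Suc K + n))) \<le> C * \<phi> (r (Suc K))"
      using C0 by (intro mult_left_mono) auto
    with bound[of n] d0[of "K + n"] show ?thesis by (simp add: add.commute)
  qed
  then have "summable (\<lambda>i. d (i + Suc K))" by (rule summableI_nonneg_bounded[OF d0])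
  then show summ: "summable (\<lambda>k. norm (x (Suc k) - x k))"
    unfolding d_def by (subst (asm) summable_iff_shift)
  then obtain l where "x \<longlonglongrightarrow> l" using convergent_of_summable_steps convergent_def by blast
  with s show "x \<longlonglongrightarrow> xbar" using LIMSEQ_subseq_LIMSEQ LIMSEQ_unique by metis
qed

section \<open>First-order conditions\<close>

text \<open>\<open>grad\<close> is a definite description, so existence and uniqueness are both at
  stake. The adjoint of the derivative, evaluated at 1, represents it as an inner product, and the
  derivative is unique.\<close>

lemma GDERIV_grad:
  assumes "rpart f differentiable (at y)"
  shows "GDERIV (rpart f) y :> grad f y"
proof -
  obtain f' where f': "(rpart f has_derivative f') (at y)"
    using assms differentiable_def by blast
  then have "linear f'" by (rule has_derivative_linear)
  then have "f' = (\<lambda>v. v \<bullet> adjoint f' 1)" using adjoint_works[of f' _ 1] by auto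
  with f' have ex: "GDERIV (rpart f) y :> adjoint f' 1" by (simp add: gderiv_def)
  moreover have "v = adjoint f' 1" if "GDERIV (rpart f) y :> v" for v
  proof -
    have "(\<lambda>w. w \<bullet> v) = (\<lambda>w. w \<bullet> adjoint f' 1)"
      using that ex unfolding gderiv_def by (rule has_derivative_unique)
    then show ?thesis by (metis vector_eq_ldot)
  qed
  ultimately show ?thesis unfolding grad_def by (rule theI)
qed

lemma GDERIV_along_segment:
  fixes y :: "'a::real_inner"
  assumes "GDERIV q (p + t *\<^sub>R (y - p)) :> c"
  shows "((\<lambda>t. q (p + t *\<^sub>R (y - p))) has_real_derivative (y - p) \<bullet> c) (at t)"
proof -
  have "((\<lambda>t. p + t *\<^sub>R (y - p)) has_derivative (\<lambda>t. t *\<^sub>R (y - p))) (at t)"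
    by (auto intro!: derivative_eq_intros)
  from has_derivative_compose[OF this assms[unfolded gderiv_def]]
  show ?thesis by (simp add: has_field_derivative_def mult.commute[of _ "(y - p) \<bullet> c"])
qed

text \<open>The conclusion says that \<open>- c\<close> is a subgradient of \<open>G\<close> at
  \<open>p\<close>. A violation at \<open>y\<close> would give a descent direction from
  \<open>p\<close> towards \<open>y\<close>, contradicting minimality.\<close>

lemma first_order_optimality:
  fixes p :: "'a::real_inner"
  assumes q: "GDERIV q p :> c" and G: "convex_on S G" and "p \<in> S" "y \<in> S"
    and min: "\<And>y. y \<in> S \<Longrightarrow> q p + G p \<le> q y + G y"
  shows "G p - (y - p) \<bullet> c \<le> G y"
proof (rule ccontr)
  assume "\<not> ?thesis"
  then have neg: "(y - p) \<bullet> c + (G y - G p) < 0" by simp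
  \<comment> \<open>Up to the constant \<open>G p\<close>, this replaces \<open>G\<close> on the
    segment by its chord, an upper bound that is differentiable in \<open>t\<close> even if
    \<open>G\<close> is not.\<close>
  define \<psi> where "\<psi> t = q (p + t *\<^sub>R (y - p)) + t * (G y - G p)" for t
  have "((\<lambda>t. q (p + t *\<^sub>R (y - p))) has_real_derivative (y - p) \<bullet> c) (at 0)"
    using q by (intro GDERIV_along_segment) simp
  then have "(\<psi> has_real_derivative (y - p) \<bullet> c + (G y - G p)) (at 0)"
    unfolding \<psi>_def by (auto intro!: derivative_eq_intros)
  from DERIV_neg_dec_right[OF this neg] obtain \<delta> where
    \<delta>: "\<delta> > 0" "\<And>t. 0 < t \<Longrightarrow> t < \<delta> \<Longrightarrow> \<psi> t < \<psi> 0" by auto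
  define t where "t = min (\<delta> / 2) 1"
  have t: "0 < t" "t < \<delta>" "t \<le> 1" using \<delta> by (auto simp: t_def)
  have eq: "(1 - t) *\<^sub>R p + t *\<^sub>R y = p + t *\<^sub>R (y - p)" by (simp add: algebra_simps)
  have "G (p + t *\<^sub>R (y - p)) \<le> (1 - t) * G p + t * G y"
    using convex_onD[OF G, of t p y] t assms(3,4) eq by simp
  moreover have "convex S" using G by (simp add: convex_on_def)
  then have "p + t *\<^sub>R (y - p) \<in> S"
    using convexD_alt[of S p y t] t assms(3,4) eq by simp
  then have "q p + G p \<le> q (p + t *\<^sub>R (y - p)) + G (p + t *\<^sub>R (y - p))" by (rule min)
  ultimately have "\<psi> 0 \<le> \<psi> t" by (simp add: \<psi>_def algebra_simps)
  with \<delta>(2)[OF t(1,2)] show False by simp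
qed

text \<open>With \<open>q = - G\<close> the sum \<open>q + G\<close> vanishes identically, so every
  point is a minimizer and the optimality condition applies at \<open>z\<close>.\<close>

lemma convex_above_tangent:
  fixes z :: "'a::real_inner"
  assumes "convex_on S G" "GDERIV G z :> c" "z \<in> S" "y \<in> S"
  shows "G z + (y - z) \<bullet> c \<le> G y"
  using first_order_optimality[OF GDERIV_minus[OF assms(2)] assms(1,3,4)] by (simp add: algebra_simps)

text \<open>The mean value theorem along the segment gives the constant \<open>L\<close> instead of
  the sharper \<open>L / 2\<close>; this is enough for a lower bound on bounded sets.\<close>

lemma Lipschitz_gradient_lower_bound:
  fixes z y :: "'a::real_inner"
  assumes e: "\<And>w. w \<in> closed_segment z y \<Longrightarrow> GDERIV e w :> G w"
    and L: "L-lipschitz_on (closed_segment z y) G"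
  shows "e z + (y - z) \<bullet> G z - L * (norm (y - z))\<^sup>2 \<le> e y"
proof -
  have seg: "z + t *\<^sub>R (y - z) \<in> closed_segment z y" if "0 \<le> t" "t \<le> 1" for t
    using that unfolding closed_segment_def by (force simp: algebra_simps)
  have "\<exists>t. 0 < t \<and> t < 1 \<and> e (z + 1 *\<^sub>R (y - z)) - e (z + 0 *\<^sub>R (y - z))
      = (1 - 0) * ((y - z) \<bullet> G (z + t *\<^sub>R (y - z)))"
    by (intro MVT2 GDERIV_along_segment e seg) auto
  then obtain t where t: "0 < t" "t < 1" and eq: "e y - e z = (y - z) \<bullet> G (z + t *\<^sub>R (y - z))"
    by auto
  define w where "w = z + t *\<^sub>R (y - z)"
  have "w \<in> closed_segment z y" using seg t by (simp add: w_def)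
  then have "norm (G z - G w) \<le> L * norm (z - w)"
    using lipschitz_onD[OF L, of z w] by (simp add: dist_norm)
  also have "\<dots> \<le> L * norm (y - z)"
    using t lipschitz_on_nonneg[OF L]
    by (intro mult_left_mono) (auto simp: w_def intro: mult_left_le_one_le)
  finally have "norm (y - z) * norm (G z - G w) \<le> norm (y - z) * (L * norm (y - z))"
    by (intro mult_left_mono) auto
  moreover have "(y - z) \<bullet> (G z - G w) \<le> norm (y - z) * norm (G z - G w)"
    by (rule norm_cauchy_schwarz)
  ultimately show ?thesis using eq
    by (simp add: w_def[symmetric] inner_diff_right power2_eq_square mult.left_commute)
qed

section \<open>Subdifferentials and extended-valued functions\<close>

text \<open>The first-order error of \<open>f\<close> at \<open>p\<close> is negligible against
  \<open>norm (y - p)\<close>, and \<open>g\<close> stays above an affine function of slope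
  \<open>v\<close> that touches it at \<open>p\<close>. Interiority of \<open>p\<close> keeps
  \<open>f\<close> finite nearby.\<close>

lemma frechet_subdiff_add:
  fixes f g :: "'a::euclidean_space \<Rightarrow> ereal"
  assumes f: "GDERIV (rpart f) p :> c" "p \<in> interior (edom f)" "\<And>y. f y \<noteq> -\<infinity>"
    and g: "\<And>y. g y \<noteq> -\<infinity>" "p \<in> edom g"
    and sub: "\<And>y. y \<in> edom g \<Longrightarrow> rpart g p + (y - p) \<bullet> v \<le> rpart g y"
  shows "c + v \<in> frechet_subdiff (\<lambda>y. f y + g y) p"
proof -
  have fin_f: "f y = ereal (rpart f y)" if "y \<in> interior (edom f)" for y
    using that f(3)[of y] interior_subset[of "edom f"] by (cases "f y") (auto simp: edom_def)
  have fin_g: "g y = ereal (rpart g y)" if "y \<in> edom g" for y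
    using that g(1)[of y] by (cases "g y") (auto simp: edom_def)
  have Fp: "f p + g p = ereal (rpart f p + rpart g p)"
    using fin_f[OF f(2)] fin_g[OF g(2)] by (metis plus_ereal.simps(1))
  have "\<forall>\<^sub>F y in at p. m < (f y + g y - (f p + g p) - ereal ((c + v) \<bullet> (y - p))) / ereal (norm (y - p))"
    if "m < 0" for m
  proof -
    \<comment> \<open>\<open>m\<close> is an extended real, possibly minus infinity; a real number
      strictly between it and 0 supplies the tolerance.\<close>
    obtain \<epsilon> :: real where \<epsilon>: "\<epsilon> > 0" "m < ereal (- \<epsilon>)"
    proof -
      from \<open>m < 0\<close> obtain \<mu> :: real where "m < ereal \<mu>" "ereal \<mu> < 0"
        using ereal_dense2 by (metis zero_ereal_def)
      then show ?thesis using that[of "- \<mu>"] by auto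
    qed
    have "\<forall>\<^sub>F y in at p. norm (rpart f y - rpart f p - (y - p) \<bullet> c) \<le> \<epsilon> * norm (y - p)"
      using f(1) \<epsilon>(1) unfolding gderiv_def has_derivative_within_alt2 by blast
    moreover have "\<forall>\<^sub>F y in at p. y \<in> interior (edom f)"
      using f(2) by (intro eventually_at_in_open') auto
    moreover have "\<forall>\<^sub>F y in at p. y \<noteq> p" by (rule eventually_neq_at_within)
    ultimately show ?thesis
    proof eventually_elim
      case (elim y)
      then have n: "norm (y - p) > 0" by simp
      show ?case
      proof (cases "y \<in> edom g")
        case False
        then have "g y = \<infinity>" by (auto simp: edom_def)
        moreover have "f y + g y = \<infinity>" using \<open>g y = \<infinity>\<close> by simp
        ultimately have "(f y + g y - (f p + g p) - ereal ((c + v) \<bullet> (y - p))) / ereal (norm (y - p)) = \<infinity>"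
          using n by (simp add: Fp divide_ereal_def)
        then show ?thesis using \<open>m < 0\<close> by auto
      next
        case True
        have "f y + g y = ereal (rpart f y + rpart g y)"
          using fin_f[OF elim(2)] fin_g[OF True] by (metis plus_ereal.simps(1))
        with Fp n have "(f y + g y - (f p + g p) - ereal ((c + v) \<bullet> (y - p))) / ereal (norm (y - p))
          = ereal ((rpart f y + rpart g y - (rpart f p + rpart g p) - (c + v) \<bullet> (y - p)) / norm (y - p))"
          by simp
        moreover have "- \<epsilon> \<le> (rpart f y + rpart g y - (rpart f p + rpart g p) - (c + v) \<bullet> (y - p)) / norm (y - p)"
          using elim(1) sub[OF True] n
          by (simp add: pos_le_divide_eq inner_add_right inner_commute[of _ "y - p"])
        ultimately show ?thesis using \<epsilon>(2) by (metis ereal_less_eq(3) less_le_trans)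
      qed
    qed
  qed
  with Fp show ?thesis unfolding frechet_subdiff_def le_Liminf_iff by simp
qed

lemma limiting_subdiffI:
  assumes "\<bar>F x\<bar> \<noteq> \<infinity>" "y \<longlonglongrightarrow> x" "(\<lambda>n. F (y n)) \<longlonglongrightarrow> F x"
    "\<And>n. u n \<in> frechet_subdiff F (y n)" "u \<longlonglongrightarrow> v"
  shows "v \<in> limiting_subdiff F x"
  unfolding limiting_subdiff_def mem_Collect_eq
  by (intro conjI exI[of _ y] exI[of _ u] allI assms)

lemma frechet_subdiff_imp_limiting_subdiff:
  assumes "v \<in> frechet_subdiff F x"
  shows "v \<in> limiting_subdiff F x"
  using assms by (intro limiting_subdiffI[of F x "\<lambda>_. x" "\<lambda>_. v"]) (auto simp: frechet_subdiff_def)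

text \<open>Turns the extended-real inequality into a real one: the norm of any single Frechet
  subgradient bounds the distance from 0 to the limiting subdifferential from above, and
  \<open>deriv \<phi>\<close> is positive.\<close>

lemma KL_property_frechet_subdiff:
  assumes KL: "\<And>y. y \<in> U \<Longrightarrow> F xbar < F y \<Longrightarrow> F y < F xbar + ereal \<eta> \<Longrightarrow>
      1 \<le> ereal (deriv \<phi> (real_of_ereal (F y - F xbar))) * subdiff_dist F y"
    and \<phi>: "\<phi> \<in> KL_desingularizing \<eta>"
    and "F xbar = ereal a" "F y = ereal b" "y \<in> U" "0 < b - a" "b - a < \<eta>"
    and u: "u \<in> frechet_subdiff F y"
  shows "1 \<le> deriv \<phi> (b - a) * norm u"
proof -
  have "deriv \<phi> (b - a) > 0" using assms by (auto simp: KL_desingularizing_def)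
  moreover have "subdiff_dist F y \<le> ereal (norm u)"
    unfolding subdiff_dist_def by (rule INF_lower[OF frechet_subdiff_imp_limiting_subdiff[OF u]])
  ultimately have "ereal (deriv \<phi> (b - a)) * subdiff_dist F y \<le> ereal (deriv \<phi> (b - a)) * ereal (norm u)"
    by (intro ereal_mult_left_mono) auto
  moreover have "1 \<le> ereal (deriv \<phi> (b - a)) * subdiff_dist F y"
    using KL[of y] assms by simp
  ultimately have "1 \<le> ereal (deriv \<phi> (b - a)) * ereal (norm u)" by (rule order_trans[rotated])
  then show ?thesis by (simp add: one_ereal_def)
qed

lemma coercive_sublevel_bounded:
  fixes F :: "'a::real_normed_vector \<Rightarrow> ereal"
  assumes "(F \<longlongrightarrow> \<infinity>) at_infinity"
  shows "bounded {y. F y \<le> ereal c}"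
proof -
  have "\<forall>\<^sub>F y in at_infinity. ereal c < F y" using assms by (rule order_tendstoD) simp
  then obtain b where "\<And>y. b \<le> norm y \<Longrightarrow> ereal c < F y"
    by (auto simp: eventually_at_infinity)
  then have "norm y \<le> b" if "F y \<le> ereal c" for y
    using that by (meson leD nle_le)
  then show ?thesis by (auto intro: boundedI)
qed

text \<open>\<open>Liminf (at p)\<close> sees only points other than \<open>p\<close>, so the
  sequence has to avoid \<open>p\<close>. Points of the domain of \<open>g\<close> do so
  automatically when \<open>g p\<close> is infinite.\<close>

lemma lsc_tendsto_infinity:
  fixes g :: "'a::euclidean_space \<Rightarrow> ereal"
  assumes "lsc g" "g p = \<infinity>" "y \<longlonglongrightarrow> p" "\<And>n. y n \<noteq> p"
  shows "(\<lambda>n. g (y n)) \<longlonglongrightarrow> \<infinity>"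
proof -
  have "\<infinity> \<le> Liminf (at p) g" using assms(1,2) unfolding lsc_def by metis
  then have ev: "\<forall>\<^sub>F z in at p. ereal c < g z" for c by (simp add: le_Liminf_iff)
  have "filterlim y (at p) sequentially" using assms(3,4) by (simp add: filterlim_at)
  then have "\<forall>\<^sub>F n in sequentially. ereal c < g (y n)" for c
    using ev by (rule eventually_compose_filterlim[rotated])
  then show ?thesis by (simp add: tendsto_PInfty)
qed

section \<open>Convergence of the algorithm\<close>

theorem theorem4p1:
  fixes f g F :: "real ^ 'n \<Rightarrow> ereal"
    and D :: "(real ^ 'n) set"
    and h :: "real ^ 'n \<Rightarrow> real ^ 'n \<Rightarrow> ereal"
    and x0 :: "real ^ 'n" and x :: "nat \<Rightarrow> real ^ 'n"
  assumes D_def: "D = interior (edom f)"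
    and F_def: "F = (\<lambda>y. f y + g y)"
    and A1a: "proper f" "D \<noteq> {}"
      "\<forall>y\<in>D. rpart f differentiable (at y)" "continuous_on D (grad f)"
    and A1b: "g \<in> Gamma0" "edom g \<subseteq> D"
    and A1c: "(F \<longlongrightarrow> \<infinity>) at_infinity" "continuous_on (edom F) F"
      "\<exists>Finf::real. \<forall>y. ereal Finf \<le> F y"
    and A2: "\<forall>z\<in>D. h z \<in> Legendre \<and> D \<subseteq> interior (edom (h z))"
      "\<forall>y\<in>D. \<forall>z\<in>D. f y \<le> bregman_majorant f h y z"
    and x0: "x0 \<in> edom g"
    and MM: "bregman_MM f g h x0 x"
    and A3a: "\<exists>\<gamma>inf>0. \<exists>\<gamma> :: nat \<Rightarrow> real. \<forall>k. \<gamma>inf \<le> \<gamma> k \<and>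
      (\<forall>y\<in>edom g. bregman_majorant f h y (x k) - f y \<ge> ereal (\<gamma> k / 2 * (norm (y - x k))\<^sup>2))"
    and A3b: "\<exists>Lsup>0. \<exists>L :: nat \<Rightarrow> real. \<forall>k. L k \<le> Lsup \<and>
      (\<forall>C. compact C \<longrightarrow> C \<subseteq> edom g \<longrightarrow> (L k)-lipschitz_on C (\<lambda>y. grad f y - grad (h (x k)) y))"
    and A4: "\<forall>y\<in>subdiff_dom F. KL_property F y"
  shows "(\<lambda>k. norm (x (Suc k) - x k)) summable_on {1..} \<and>
    (\<exists>xlim. x \<longlonglongrightarrow> xlim \<and> critical_point F xlim)"
proof -

  \<comment> \<open>Real-valued representatives of the extended-valued data\<close>
  define fr gr hr where "fr = rpart f" and "gr = rpart g" and "hr z = rpart (h z)" for z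
  define Fr where "Fr y = fr y + gr y" for y
  \<comment> \<open>The base point \<open>z\<close> comes first here, whereas
    \<open>bregman_majorant\<close> takes it last.\<close>
  define Q where "Q z y = fr z + grad f z \<bullet> (y - z) + (hr z y - hr z z - grad (h z) z \<bullet> (y - z))" for z y
  have D_open: "open D" by (simp add: D_def)
  have g: "\<And>y. g y \<noteq> -\<infinity>" "lsc g" "convex_on (edom g) gr"
    using A1b(1) by (auto simp: Gamma0_def proper_def gr_def)
  have f: "\<And>y. f y \<noteq> -\<infinity>" using A1a(1) by (simp add: proper_def)
  have gD: "y \<in> D" if "y \<in> edom g" for y using that A1b(2) by auto
  have g_fin: "g y = ereal (gr y)" if "y \<in> edom g" for y
    using that g(1)[of y] by (cases "g y") (auto simp: edom_def gr_def)
  have f_fin: "f y = ereal (fr y)" if "y \<in> D" for y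
    using that f[of y] interior_subset[of "edom f"] unfolding D_def
    by (cases "f y") (auto simp: edom_def fr_def)
  have h: "h z \<in> Gamma0" "essentially_smooth (h z)" "D \<subseteq> interior (edom (h z))" if "z \<in> D" for z
    using A2(1) that by (auto simp: Legendre_def)
  have h_fin: "h z y = ereal (hr z y)" if "z \<in> D" "y \<in> D" for z y
  proof -
    have "y \<in> edom (h z)" using h(3)[OF that(1)] that(2) interior_subset by blast
    moreover have "h z y \<noteq> -\<infinity>" using h(1)[OF that(1)] by (simp add: Gamma0_def proper_def)
    ultimately show ?thesis by (cases "h z y") (auto simp: edom_def hr_def)
  qed
  have f_deriv: "GDERIV fr y :> grad f y" if "y \<in> D" for y
    unfolding fr_def using A1a(3) that by (intro GDERIV_grad) auto
  have h_deriv: "GDERIV (hr z) y :> grad (h z) y" if "z \<in> D" "y \<in> D" for z y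
    unfolding hr_def using h(2,3)[OF that(1)] that(2)
    by (intro GDERIV_grad) (auto simp: essentially_smooth_def)
  have maj: "bregman_majorant f h y z = ereal (Q z y)" if "z \<in> D" "y \<in> D" for z y
    using that by (simp add: bregman_majorant_def bregman_def Q_def f_fin h_fin)
  have Qzz: "Q z z = fr z" for z by (simp add: Q_def)
  have edom_F: "edom F = edom g"
  proof -
    have "g y < \<infinity>" if "F y < \<infinity>" for y using that f[of y] unfolding F_def by (cases "g y") auto
    moreover have "F y < \<infinity>" if "y \<in> edom g" for y
      using f_fin[OF gD[OF that]] g_fin[OF that] by (simp add: F_def)
    ultimately show ?thesis by (auto simp: edom_def)
  qed
  have F_fin: "F y = ereal (Fr y)" if "y \<in> edom g" for y
    using f_fin[OF gD[OF that]] g_fin[OF that] by (simp add: F_def Fr_def)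

  \<comment> \<open>Feasibility and minimality of the iterates\<close>
  have x_0: "x 0 = x0"
    and step: "\<And>k y. bregman_majorant f h (x (Suc k)) (x k) + g (x (Suc k)) \<le> bregman_majorant f h y (x k) + g y"
    using MM by (auto simp: bregman_MM_def is_arg_min_linorder)
  have x_dom: "x k \<in> edom g" for k
  proof (induction k)
    case 0
    then show ?case using x0 x_0 by simp
  next
    case (Suc k)
    \<comment> \<open>The previous iterate is a competitor with finite objective value.\<close>
    have "bregman_majorant f h (x (Suc k)) (x k) + g (x (Suc k)) \<le> ereal (Q (x k) (x k) + gr (x k))"
      using step[of k "x k"] maj[OF gD gD, OF Suc Suc] g_fin[OF Suc] by simp
    then have "g (x (Suc k)) \<noteq> \<infinity>" by auto
    then show ?case by (simp add: edom_def less_top[symmetric] top_ereal_def)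
  qed
  note x_D = gD[OF x_dom]
  have x_min: "Q (x k) (x (Suc k)) + gr (x (Suc k)) \<le> Q (x k) y + gr y" if "y \<in> edom g" for k y
    using step[of k y] maj[OF x_D gD[OF that]] maj[OF x_D x_D] g_fin[OF that] g_fin[OF x_dom] by simp

  \<comment> \<open>Sufficient decrease\<close>
  obtain \<gamma> :: real where \<gamma>: "\<gamma> > 0"
    and maj_gap: "\<And>k y. y \<in> edom g \<Longrightarrow> \<gamma> / 2 * (norm (y - x k))\<^sup>2 \<le> Q (x k) y - fr y"
  proof -
    obtain \<gamma>inf \<gamma> where "\<gamma>inf > 0" and *: "\<And>k. \<gamma>inf \<le> \<gamma> k"
      "\<And>k y. y \<in> edom g \<Longrightarrow> bregman_majorant f h y (x k) - f y \<ge> ereal (\<gamma> k / 2 * (norm (y - x k))\<^sup>2)"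
      using A3a by metis
    have "\<gamma>inf / 2 * (norm (y - x k))\<^sup>2 \<le> Q (x k) y - fr y" if "y \<in> edom g" for k y
    proof -
      have "\<gamma>inf / 2 * (norm (y - x k))\<^sup>2 \<le> \<gamma> k / 2 * (norm (y - x k))\<^sup>2"
        using *(1)[of k] by (intro mult_right_mono) auto
      also have "\<dots> \<le> Q (x k) y - fr y"
        using *(2)[OF that, of k] maj[OF x_D gD[OF that]] f_fin[OF gD[OF that]] by simp
      finally show ?thesis .
    qed
    with \<open>\<gamma>inf > 0\<close> that show thesis by blast
  qed
  have dec: "\<gamma> / 2 * (norm (x (Suc k) - x k))\<^sup>2 \<le> Fr (x k) - Fr (x (Suc k))" for k
    using maj_gap[OF x_dom, of "Suc k" k] x_min[OF x_dom, of k k] by (simp add: Qzz Fr_def)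

  \<comment> \<open>Subgradients of \<open>F\<close> at the iterates\<close>
  obtain L where L: "L > 0"
    and Lip: "\<And>k C. compact C \<Longrightarrow> C \<subseteq> edom g \<Longrightarrow> L-lipschitz_on C (\<lambda>y. grad f y - grad (h (x k)) y)"
  proof -
    obtain Lsup L where *: "Lsup > 0" "\<forall>k. L k \<le> Lsup \<and> (\<forall>C. compact C \<longrightarrow> C \<subseteq> edom g \<longrightarrow>
        (L k)-lipschitz_on C (\<lambda>y. grad f y - grad (h (x k)) y))"
      using A3b by (elim exE conjE)
    then have "Lsup-lipschitz_on C (\<lambda>y. grad f y - grad (h (x k)) y)"
      if "compact C" "C \<subseteq> edom g" for k C
      using that by (meson lipschitz_on_le)
    with * that show thesis by blast
  qed

  define u where "u k = grad f (x (Suc k)) - grad (h (x k)) (x (Suc k)) - (grad f (x k) - grad (h (x k)) (x k))" for k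
  have u_norm: "norm (u k) \<le> L * norm (x (Suc k) - x k)" for k
    \<comment> \<open>Two iterates form a compact subset of \<open>edom g\<close>, so the Lipschitz
      bound on compact sets applies to them directly.\<close>
    using lipschitz_onD[OF Lip[of "{x k, x (Suc k)}" k], of "x (Suc k)" "x k"] x_dom
    by (simp add: u_def dist_norm)
  have u_sub: "u k \<in> frechet_subdiff F (x (Suc k))" for k
  proof -
    define p where "p = x (Suc k)"
    \<comment> \<open>This is the gradient of \<open>Q (x k)\<close> at \<open>p\<close>. Optimality
      makes \<open>- c\<close> a subgradient of \<open>g\<close> there, and adding
      \<open>grad f p\<close> yields \<open>u k\<close>.\<close>
    define c where "c = grad f (x k) + (grad (h (x k)) p - grad (h (x k)) (x k))"
    have lin: "GDERIV (\<lambda>y. b + w \<bullet> (y - z)) y :> w" for b :: real and w z y :: "real ^ 'n"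
      unfolding gderiv_def by (auto intro!: derivative_eq_intros simp: inner_commute)
    have "GDERIV (\<lambda>y. (fr (x k) + grad f (x k) \<bullet> (y - x k)) + (hr (x k) y - (hr (x k) (x k) + grad (h (x k)) (x k) \<bullet> (y - x k)))) p :> c"
      unfolding c_def p_def by (intro GDERIV_add GDERIV_diff lin h_deriv x_D)
    then have "GDERIV (Q (x k)) p :> c" by (simp add: Q_def[abs_def] algebra_simps)
    then have "gr p - (y - p) \<bullet> c \<le> gr y" if "y \<in> edom g" for y
      by (rule first_order_optimality[OF _ g(3)]) (use that x_min x_dom in \<open>auto simp: p_def\<close>)
    then have "grad f p + (- c) \<in> frechet_subdiff F p"
      unfolding F_def using f_deriv[OF x_D] x_D x_dom f g(1)
      by (intro frechet_subdiff_add) (auto simp: fr_def gr_def D_def p_def)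
    moreover have "u k = grad f p + (- c)" by (simp add: u_def c_def p_def)
    ultimately show ?thesis by (simp add: p_def)
  qed

  \<comment> \<open>Limit of the values and existence of a cluster point\<close>
  have "decseq (\<lambda>k. Fr (x k))"
  proof (rule decseq_SucI)
    fix k
    have "0 \<le> \<gamma> / 2 * (norm (x (Suc k) - x k))\<^sup>2" using \<gamma> by simp
    with dec[of k] show "Fr (x (Suc k)) \<le> Fr (x k)" by linarith
  qed
  moreover obtain Finf where "\<And>y. ereal Finf \<le> F y" using A1c(3) by blast
  then have "Finf \<le> Fr (x k)" for k using F_fin[OF x_dom] by (metis ereal_less_eq(3))
  ultimately obtain Fstar where Fstar: "(\<lambda>k. Fr (x k)) \<longlonglongrightarrow> Fstar" "\<And>k. Fstar \<le> Fr (x k)"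
    using decseq_convergent by blast
  have Fr_le: "Fr (x k) \<le> Fr (x 0)" for k using \<open>decseq _\<close> by (simp add: decseq_def)
  have steps: "(\<lambda>k. norm (x (Suc k) - x k)) \<longlonglongrightarrow> 0"
    using \<gamma> by (intro steps_tendsto_zero[OF _ Fstar(1) dec]) simp

  have "range x \<subseteq> {y. F y \<le> ereal (Fr (x 0))}" using F_fin[OF x_dom] Fr_le by auto
  then have bdd: "bounded (range x)"
    using coercive_sublevel_bounded[OF A1c(1)] bounded_subset by blast
  then obtain xbar s where s: "strict_mono (s :: nat \<Rightarrow> nat)" "(x \<circ> s) \<longlonglongrightarrow> xbar"
    using bounded_imp_convergent_subsequence by blast

  \<comment> \<open>(A1) alone allows \<open>f\<close> to tend to \<open>-\<infinity>\<close> at a boundary point of \<open>D\<close> and so to cancel the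
    blow-up of \<open>g\<close> there. This is excluded because \<open>f\<close> is, on the domain of \<open>g\<close>, the sum of the
    convex function \<open>h (x 0)\<close> and of a function with Lipschitz gradient.\<close>
  have f_lower: "fr (x 0) + (y - x 0) \<bullet> grad f (x 0) - L * (norm (y - x 0))\<^sup>2 \<le> fr y" if y: "y \<in> edom g" for y
  proof -
    have seg: "closed_segment (x 0) y \<subseteq> edom g"
      using g(3) x_dom y by (intro closed_segment_subset) (auto simp: convex_on_def)
    have "(fr (x 0) - hr (x 0) (x 0)) + (y - x 0) \<bullet> (grad f (x 0) - grad (h (x 0)) (x 0)) - L * (norm (y - x 0))\<^sup>2
        \<le> fr y - hr (x 0) y"
      by (intro Lipschitz_gradient_lower_bound[of _ _ "\<lambda>y. fr y - hr (x 0) y"] GDERIV_diff f_deriv h_deriv x_D Lip[OF _ seg])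
        (use seg gD in auto)
    moreover have "hr (x 0) (x 0) + (y - x 0) \<bullet> grad (h (x 0)) (x 0) \<le> hr (x 0) y"
    proof (rule convex_above_tangent[OF _ h_deriv[OF x_D x_D]])
      show "convex_on (edom (h (x 0))) (hr (x 0))"
        using h(1)[OF x_D] by (simp add: Gamma0_def hr_def)
      show "x 0 \<in> edom (h (x 0))" "y \<in> edom (h (x 0))"
        using h(3)[OF x_D, of 0] x_D gD[OF y] interior_subset by blast+
    qed
    ultimately show ?thesis by (simp add: inner_diff_right)
  qed
  have xbar_dom: "xbar \<in> edom g"
  proof (rule ccontr)
    assume out: "xbar \<notin> edom g"
    then have "(\<lambda>n. g (x (s n))) \<longlonglongrightarrow> \<infinity>"
      using s(2) x_dom by (intro lsc_tendsto_infinity[OF g(2), of xbar]) (auto simp: edom_def o_def)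
    obtain B where B: "\<And>k. norm (x k - x 0) \<le> B"
    proof -
      obtain b where "\<And>k. norm (x k) \<le> b" using bdd by (auto simp: bounded_iff)
      then have "norm (x k - x 0) \<le> b + b" for k
        by (metis norm_triangle_ineq4 add_mono order_trans)
      then show thesis using that by blast
    qed
    \<comment> \<open>By \<open>f_lower\<close> and boundedness this is a lower bound for
      \<open>f\<close> along the whole sequence. As the values of \<open>F\<close> do not increase,
      \<open>g\<close> is then bounded above along it, against its blow-up.\<close>
    define c where "c = fr (x 0) - B * norm (grad f (x 0)) - L * B\<^sup>2"
    have "c \<le> fr (x k)" for k
    proof -
      have "\<bar>(x k - x 0) \<bullet> grad f (x 0)\<bar> \<le> norm (x k - x 0) * norm (grad f (x 0))"
        by (rule Cauchy_Schwarz_ineq2)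
      also have "\<dots> \<le> B * norm (grad f (x 0))" using B by (intro mult_right_mono) auto
      finally have "- (B * norm (grad f (x 0))) \<le> (x k - x 0) \<bullet> grad f (x 0)" by linarith
      moreover have "L * (norm (x k - x 0))\<^sup>2 \<le> L * B\<^sup>2"
        using L B by (intro mult_left_mono power_mono) auto
      ultimately show ?thesis using f_lower[OF x_dom, of k] by (simp add: c_def)
    qed
    then have "gr (x k) \<le> Fr (x 0) - c" for k
      using Fr_le[of k] by (simp add: Fr_def) (smt (verit))
    moreover have "\<forall>\<^sub>F n in sequentially. ereal (Fr (x 0) - c) < g (x (s n))"
      using \<open>(\<lambda>n. g (x (s n))) \<longlonglongrightarrow> \<infinity>\<close> by (rule order_tendstoD) simp
    then obtain n where "ereal (Fr (x 0) - c) < g (x (s n))"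
      using eventually_happens' trivial_limit_sequentially by blast
    ultimately show False using g_fin[OF x_dom] by (metis ereal_less_eq(3) leD)
  qed

  \<comment> \<open>Criticality of the cluster point\<close>
  have F_lim: "(\<lambda>n. F (x (s n))) \<longlonglongrightarrow> F xbar"
    using s(2) x_dom xbar_dom edom_F
    by (intro continuous_on_tendsto_compose[OF A1c(2)]) (auto simp: o_def)
  then have "(\<lambda>n. Fr (x (s n))) \<longlonglongrightarrow> Fr xbar" using F_fin x_dom xbar_dom by simp
  moreover have "(\<lambda>n. Fr (x (s n))) \<longlonglongrightarrow> Fstar"
    using LIMSEQ_subseq_LIMSEQ[OF Fstar(1) s(1)] by (simp add: o_def)
  \<comment> \<open>Hence the gap to the limit value is the gap to \<open>F xbar\<close> that occurs
    in the Kurdyka-Lojasiewicz inequality at \<open>xbar\<close>.\<close>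
  ultimately have Fr_xbar: "Fr xbar = Fstar" by (rule LIMSEQ_unique)

  have crit: "0 \<in> limiting_subdiff F xbar"
  proof -
    have "(\<lambda>k. L * norm (x (Suc k) - x k)) \<longlonglongrightarrow> L * 0" by (intro tendsto_intros steps)
    then have "(\<lambda>k. norm (u k)) \<longlonglongrightarrow> 0"
      by (intro Lim_null_comparison[of "\<lambda>k. norm (u k)" "\<lambda>k. L * norm (x (Suc k) - x k)"]) (use u_norm in auto)
    then have u_lim: "u \<longlonglongrightarrow> 0" by (rule tendsto_norm_zero_cancel)
    have s_lim: "filterlim s at_top sequentially" using s(1) by (rule filterlim_subseq)
    \<comment> \<open>The subgradient \<open>u k\<close> sits at \<open>x (Suc k)\<close>, so the
      subsequence is shifted by one; vanishing steps preserve its limit.\<close>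
    have "(\<lambda>n. x (Suc (s n)) - x (s n)) \<longlonglongrightarrow> 0"
      using filterlim_compose[OF tendsto_norm_zero_cancel[OF steps] s_lim] by simp
    from tendsto_add[OF this s(2)] have x_lim: "(\<lambda>n. x (Suc (s n))) \<longlonglongrightarrow> xbar" by (simp add: o_def)
    then have "(\<lambda>n. F (x (Suc (s n)))) \<longlonglongrightarrow> F xbar"
      using x_dom xbar_dom edom_F by (intro continuous_on_tendsto_compose[OF A1c(2)]) auto
    moreover have "(\<lambda>n. u (s n)) \<longlonglongrightarrow> 0" using filterlim_compose[OF u_lim s_lim] .
    ultimately show ?thesis
      using F_fin[OF xbar_dom] x_lim u_sub
      by (intro limiting_subdiffI[of F xbar "\<lambda>n. x (Suc (s n))" "\<lambda>n. u (s n)"]) auto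
  qed

  \<comment> \<open>Finite length and convergence of the whole sequence\<close>
  then have "KL_property F xbar" using A4 by (auto simp: subdiff_dom_def)
  then obtain \<eta> U \<phi> where KL: "\<eta> > 0" "\<phi> \<in> KL_desingularizing \<eta>" "open U" "xbar \<in> U"
    "\<And>y. y \<in> U \<Longrightarrow> F xbar < F y \<Longrightarrow> F y < F xbar + ereal \<eta> \<Longrightarrow>
      1 \<le> ereal (deriv \<phi> (real_of_ereal (F y - F xbar))) * subdiff_dist F y"
    unfolding KL_property_def by blast
  have r_lim: "(\<lambda>k. Fr (x k) - Fstar) \<longlonglongrightarrow> 0"
    using tendsto_diff[OF Fstar(1) tendsto_const[of Fstar]] by simp
  have KL_x: "1 \<le> deriv \<phi> (Fr (x (Suc k)) - Fstar) * (L * norm (x (Suc k) - x k))"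
    if "x (Suc k) \<in> U" and r: "0 < Fr (x (Suc k)) - Fstar" "Fr (x (Suc k)) - Fstar < \<eta>" for k
  proof -
    have "1 \<le> deriv \<phi> (Fr (x (Suc k)) - Fstar) * norm (u k)"
      using KL_property_frechet_subdiff[OF KL(5,2) _ F_fin[OF x_dom] that(1) r u_sub]
        F_fin[OF xbar_dom] Fr_xbar by simp
    also have "\<dots> \<le> deriv \<phi> (Fr (x (Suc k)) - Fstar) * (L * norm (x (Suc k) - x k))"
      using KL(2) r by (intro mult_left_mono u_norm) (auto simp: KL_desingularizing_def intro: less_imp_le)
    finally show ?thesis .
  qed
  have "summable (\<lambda>k. norm (x (Suc k) - x k))" "x \<longlonglongrightarrow> xbar"
    using KL_finite_length[OF KL(2,1,3,4) _ _ _ r_lim _ KL_x s, of "\<gamma> / 2"] \<gamma> L dec Fstar(2)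
    by simp_all
  \<comment> \<open>Absolute convergence gives unordered summability over all indices, which
    restricts to the indices from 1 on.\<close>
  then have "(\<lambda>k. norm (x (Suc k) - x k)) summable_on UNIV"
    by (intro norm_summable_imp_summable_on) simp
  then have "(\<lambda>k. norm (x (Suc k) - x k)) summable_on {1..}"
    by (rule summable_on_subset_banach) simp
  with \<open>x \<longlonglongrightarrow> xbar\<close> crit show ?thesis by (auto simp: critical_point_def)
qed

end
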